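(* Let $X$ be a metrizable space. The following statements are equivalent: (1) $X$ is metrizable by a cofinally Bourbaki-complete (equivalently, uniformly strongly paracompact) metric; (2) $X$ is strongly paracompact and $nlc(X)$ is compact.
   Context: "Metrizable by a metric $d$" means that $d$ induces the topology of $X$. For a metric space $(X,d)$, the metric uniformity $\mu_d$ is the family of covers of $X$ (uniform covers) refined by $\{B_d(x,\varepsilon):x\in X\}$ for some $\varepsilon>0$. For a cover $\mathcal U$ of $X$ and $A\subset X$: $St(A,\mathcal U)=\bigcup\{U\in\mathcal U: U\cap A\neq\emptyset\}$, $St^0(A,\mathcal U)=A$, $St^m(A,\mathcal U)=St(St^{m-1}(A,\mathcal U),\mathcal U)$ for $m\geq 1$. A filter $\mathcal F$ on $X$ is cofinally Bourbaki-Cauchy if for every $\mathcal U\in\mu_d$ there are $m\in\mathbb N$ and $U\in\mathcal U$ with $F\cap St^m(U,\mathcal U)\neq\emptyset$ for all $F\in\mathcal F$. The metric $d$ is cofinally Bourbaki-complete if every cofinally Bourbaki-Cauchy filter has a cluster point. The metric $d$ is uniformly strongly paracompact if every open cover of $X$ has an open refinement $\mathcal A$ for which there is $\mathcal U\in\mu_d$ such that for every $A\in\mathcal A$ the set $St(A,\mathcal U)$ meets at most finitely many $A'\in\mathcal A$. (These two properties of $d$ are equivalent.) A cover is star-finite if each of its members meets at most finitely many of its members. $X$ is strongly paracompact if every open cover has a star-finite open refinement. $nlc(X)$ is the set of points of $X$ having no compact neighborhood in $X$ (possibly empty). *)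

theory Defs
  imports "HOL-Analysis.Analysis"
begin

definition open_cover_of :: "'a topology \<Rightarrow> 'a set set \<Rightarrow> bool" where
  "open_cover_of X \<U> \<longleftrightarrow> (\<forall>U\<in>\<U>. openin X U) \<and> \<Union>\<U> = topspace X"

definition refines :: "'a set set \<Rightarrow> 'a set set \<Rightarrow> bool" where
  "refines \<V> \<U> \<longleftrightarrow> (\<forall>V\<in>\<V>. \<exists>U\<in>\<U>. V \<subseteq> U)"

definition star :: "'a set \<Rightarrow> 'a set set \<Rightarrow> 'a set" where
  "star A \<U> = \<Union>{U \<in> \<U>. U \<inter> A \<noteq> {}}"

primrec iter_star :: "nat \<Rightarrow> 'a set \<Rightarrow> 'a set set \<Rightarrow> 'a set" where
  "iter_star 0 A \<U> = A"
| "iter_star (Suc m) A \<U> = star (iter_star m A \<U>) \<U>"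

definition star_finite :: "'a set set \<Rightarrow> bool" where
  "star_finite \<A> \<longleftrightarrow> (\<forall>A\<in>\<A>. finite {B \<in> \<A>. A \<inter> B \<noteq> {}})"

definition strongly_paracompact :: "'a topology \<Rightarrow> bool" where
  "strongly_paracompact X \<longleftrightarrow>
     (\<forall>\<U>. open_cover_of X \<U> \<longrightarrow>
        (\<exists>\<A>. open_cover_of X \<A> \<and> refines \<A> \<U> \<and> star_finite \<A>))"

definition nlc :: "'a topology \<Rightarrow> 'a set" where
  "nlc X = {x \<in> topspace X.
     \<not> (\<exists>U K. openin X U \<and> compactin X K \<and> x \<in> U \<and> U \<subseteq> K)}"

definition cluster_point_in :: "'a topology \<Rightarrow> 'a filter \<Rightarrow> 'a \<Rightarrow> bool" where
  "cluster_point_in X \<F> x \<longleftrightarrow> x \<in> topspace X \<and>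
     (\<forall>W F. openin X W \<and> x \<in> W \<and> eventually (\<lambda>y. y \<in> F) \<F> \<longrightarrow> F \<inter> W \<noteq> {})"

context Metric_space
begin

definition metric_uniformity :: "'a set set set" where
  "metric_uniformity =
     {\<U>. \<Union>\<U> = M \<and> (\<exists>\<epsilon>>0. refines {mball x \<epsilon> | x. x \<in> M} \<U>)}"

text \<open>A filter on the set \<open>M\<close> is represented by a proper filter on the ambient type
  that has \<open>M\<close> as a member; \<open>F\<close> is a member of \<open>\<F>\<close> iff
  \<open>eventually (\<lambda>y. y \<in> F) \<F>\<close>.\<close>

definition cofinally_Bourbaki_Cauchy :: "'a filter \<Rightarrow> bool" where
  "cofinally_Bourbaki_Cauchy \<F> \<longleftrightarrow>
     \<F> \<noteq> bot \<and> eventually (\<lambda>y. y \<in> M) \<F> \<and>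
     (\<forall>\<U>\<in>metric_uniformity. \<exists>m. \<exists>U\<in>\<U>. \<forall>F.
        eventually (\<lambda>y. y \<in> F) \<F> \<longrightarrow> F \<inter> iter_star m U \<U> \<noteq> {})"

definition cofinally_Bourbaki_complete :: bool where
  "cofinally_Bourbaki_complete \<longleftrightarrow>
     (\<forall>\<F>. cofinally_Bourbaki_Cauchy \<F> \<longrightarrow> (\<exists>x. cluster_point_in mtopology \<F> x))"

definition uniformly_strongly_paracompact :: bool where
  "uniformly_strongly_paracompact \<longleftrightarrow>
     (\<forall>\<G>. open_cover_of mtopology \<G> \<longrightarrow>
        (\<exists>\<A>. open_cover_of mtopology \<A> \<and> refines \<A> \<G> \<and>
           (\<exists>\<U>\<in>metric_uniformity. \<forall>A\<in>\<A>. finite {A' \<in> \<A>. star A \<U> \<inter> A' \<noteq> {}})))"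

end

definition metrizes :: "('a \<Rightarrow> 'a \<Rightarrow> real) \<Rightarrow> 'a topology \<Rightarrow> bool" where
  "metrizes d X \<longleftrightarrow> Metric_space (topspace X) d \<and> Metric_space.mtopology (topspace X) d = X"

end

theory Submission
  imports Defs
begin

text \<open>
  All properties of the metric are compared with one condition, \<open>chain_covering\<close>: every open
  cover \<open>\<G>\<close> has an \<open>\<epsilon> > 0\<close> such that the points reached from any given point by
  \<open>\<epsilon>\<close>-chains of any given length are covered by finitely many members of \<open>\<G>\<close>. For a fixed
  metric it follows from cofinal Bourbaki-completeness, because for a cover that violates it the
  complements of finite unions generate a cofinally Bourbaki-Cauchy filter without cluster point.
  It implies uniform strong paracompactness, by cutting neighbourhoods of the layers of equal chain
  distance in each \<open>\<epsilon>\<close>-chain component. Uniform strong paracompactness in turn gives back cofinal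
  Bourbaki-completeness, since iterated stars of members of the uniform cover are covered by
  finitely many members of the refinement.

  Uniform strong paracompactness clearly implies strong paracompactness. The set \<open>nlc\<close> is compact,
  because otherwise there are a closed discrete sequence of points of \<open>nlc\<close> and infinite closed
  discrete sets in balls around these points, with radii tending to \<open>0\<close>, whose union is still
  closed and discrete; the cover by open sets with finite trace on this union violates the chain
  condition (\<open>chain_covering_imp_compactin_nlc\<close>).

  Conversely, let the space be strongly paracompact with \<open>nlc\<close> compact. For each \<open>n\<close> there is a
  star-finite open cover \<open>\<A> n\<close> whose members lie in the \<open>1/(n+1)\<close>-neighbourhood \<open>V n\<close> of
  \<open>nlc\<close> or in a compact set. Some compatible metric makes all the \<open>\<A> n\<close> uniform covers
  (\<open>metric_with_Lebesgue_numbers\<close>). In that metric, star-finiteness confines the points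
  reached from a given point by small chains of a given length to finitely many members of
  \<open>\<A> n\<close>, hence to \<open>V n\<close> together with a compact set, and by compactness every open cover has a finite subfamily covering some \<open>V n\<close>. This is the chain
  condition (\<open>chain_covering_metric_exists\<close>).
\<close>

section \<open>Finite subcovers\<close>

text \<open>Being covered by finitely many members of a family of sets.\<close>

definition finitely_covered :: "'a set set \<Rightarrow> 'a set \<Rightarrow> bool" where
  "finitely_covered \<G> S \<longleftrightarrow> (\<exists>\<H>\<subseteq>\<G>. finite \<H> \<and> S \<subseteq> \<Union>\<H>)"

lemma finitely_covered_subset:
  "finitely_covered \<G> T \<Longrightarrow> S \<subseteq> T \<Longrightarrow> finitely_covered \<G> S"
  unfolding finitely_covered_def by blast

lemma finitely_covered_UN:
  assumes "finite I" "\<And>i. i \<in> I \<Longrightarrow> finitely_covered \<G> (S i)"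
  shows "finitely_covered \<G> (\<Union>i\<in>I. S i)"
proof -
  obtain H where "\<And>i. i \<in> I \<Longrightarrow> H i \<subseteq> \<G> \<and> finite (H i) \<and> S i \<subseteq> \<Union>(H i)"
    using assms(2) unfolding finitely_covered_def by metis
  then show ?thesis
    unfolding finitely_covered_def using assms(1)
    by (intro exI[of _ "\<Union>i\<in>I. H i"]) fastforce
qed

lemma finitely_covered_compactin:
  "compactin X K \<Longrightarrow> open_cover_of X \<G> \<Longrightarrow> finitely_covered \<G> K"
  unfolding compactin_def open_cover_of_def finitely_covered_def by metis

lemma subset_star:
  "A \<subseteq> \<Union>\<U> \<Longrightarrow> A \<subseteq> star A \<U>"
  unfolding star_def by blast

section \<open>Chains of small steps\<close>

context Metric_space
begin

text \<open>The steps of an \<open>\<epsilon>\<close>-chain, as a relation on \<open>M\<close>: the points reached from \<open>a\<close> by an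
  \<open>\<epsilon>\<close>-chain of \<open>n\<close> steps form the image of \<open>{a}\<close> under the \<open>n\<close>-th power.\<close>

definition small_steps :: "real \<Rightarrow> ('a \<times> 'a) set" where
  "small_steps \<epsilon> = {(x, y). x \<in> M \<and> y \<in> M \<and> d x y < \<epsilon>}"

text \<open>Every open cover \<open>\<G>\<close> has a scale \<open>\<epsilon>\<close> at which the points reached from any point by
  \<open>\<epsilon>\<close>-chains of any fixed length are covered by finitely many members of \<open>\<G>\<close>. This
  filter-free condition is equivalent to both properties of the metric studied here. It mentions
  only balls: iterated stars of a cover that is refined by the \<open>\<epsilon>\<close>-balls contain these chains.\<close>

definition chain_covering :: bool where
  "chain_covering \<longleftrightarrow>
     (\<forall>\<G>. open_cover_of mtopology \<G> \<longrightarrow>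
        (\<exists>\<epsilon>>0. \<forall>a\<in>M. \<forall>n. finitely_covered \<G> ((small_steps \<epsilon> ^^ n) `` {a})))"

lemma small_steps_iterate_subset_iter_star:
  assumes "refines {mball x \<epsilon> | x. x \<in> M} \<U>" "a \<in> U"
  shows "(small_steps \<epsilon> ^^ n) `` {a} \<subseteq> iter_star n U \<U>"
proof (induction n)
  case 0
  then show ?case using assms by auto
next
  case (Suc n)
  show ?case
  proof
    fix y assume "y \<in> (small_steps \<epsilon> ^^ Suc n) `` {a}"
    then obtain z where z: "z \<in> (small_steps \<epsilon> ^^ n) `` {a}" "(z, y) \<in> small_steps \<epsilon>"
      by auto
    then have zM: "z \<in> M" "y \<in> M" "d z y < \<epsilon>" by (auto simp: small_steps_def)
    then obtain V where V: "V \<in> \<U>" "mball z \<epsilon> \<subseteq> V"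
      using assms(1) unfolding refines_def by blast
    have "0 < \<epsilon>" using zM nonneg[of z y] by linarith
    then have "z \<in> V" "y \<in> V" using V zM by auto
    then show "y \<in> iter_star (Suc n) U \<U>"
      using z(1) Suc.IH V(1) by (auto simp: star_def)
  qed
qed

text \<open>If \<open>\<G>\<close> violates the chain condition at every scale, then the complements of finite unions
  of members of \<open>\<G>\<close> generate a cofinally Bourbaki-Cauchy filter, which has no cluster point
  because \<open>\<G>\<close> covers the space.\<close>

lemma cofinally_Bourbaki_complete_imp_chain_covering:
  assumes cbc: cofinally_Bourbaki_complete
  shows chain_covering
  unfolding chain_covering_def
proof (intro allI impI, rule ccontr)
  fix \<G> assume G: "open_cover_of mtopology \<G>"
  assume neg: "\<not> (\<exists>\<epsilon>>0. \<forall>a\<in>M. \<forall>n. finitely_covered \<G> ((small_steps \<epsilon> ^^ n) `` {a}))"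
  define \<F> where "\<F> = (INF \<H>\<in>{\<H>. \<H> \<subseteq> \<G> \<and> finite \<H>}. principal (M - \<Union>\<H>))"
  have ev: "eventually P \<F> \<longleftrightarrow> (\<exists>\<H>. \<H> \<subseteq> \<G> \<and> finite \<H> \<and> (\<forall>x\<in>M - \<Union>\<H>. P x))" for P
    unfolding \<F>_def
  proof (subst eventually_INF_base)
    fix a b assume "a \<in> {\<H>. \<H> \<subseteq> \<G> \<and> finite \<H>}" "b \<in> {\<H>. \<H> \<subseteq> \<G> \<and> finite \<H>}"
    then show "\<exists>x\<in>{\<H>. \<H> \<subseteq> \<G> \<and> finite \<H>}.
        principal (M - \<Union>x) \<le> inf (principal (M - \<Union>a)) (principal (M - \<Union>b))"
      by (intro bexI[of _ "a \<union> b"]) auto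
  qed (auto simp: eventually_principal)
  have meets: "F \<inter> S \<noteq> {}"
    if F: "eventually (\<lambda>y. y \<in> F) \<F>" and S: "\<not> finitely_covered \<G> S" "S \<subseteq> M" for F S
  proof -
    obtain \<H> where H: "\<H> \<subseteq> \<G>" "finite \<H>" "\<forall>x\<in>M - \<Union>\<H>. x \<in> F"
      using F unfolding ev by blast
    then have "\<not> S \<subseteq> \<Union>\<H>" using S(1) unfolding finitely_covered_def by auto
    then show ?thesis using H(3) S(2) by blast
  qed
  have notfin: "\<exists>a\<in>M. \<exists>n. \<not> finitely_covered \<G> ((small_steps \<epsilon> ^^ n) `` {a})" if "\<epsilon> > 0" for \<epsilon>
    using neg that by blast
  have chain_M: "(small_steps \<epsilon> ^^ n) `` {a} \<subseteq> M" if "a \<in> M" for \<epsilon> a n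
    using that by (cases n) (auto simp: small_steps_def)
  have "cofinally_Bourbaki_Cauchy \<F>"
    unfolding cofinally_Bourbaki_Cauchy_def
  proof (intro conjI ballI)
    obtain a n where "a \<in> M" "\<not> finitely_covered \<G> ((small_steps 1 ^^ n) `` {a})"
      using notfin[of 1] by auto
    then show "\<F> \<noteq> bot"
      using meets[of "{}"] chain_M by (metis Int_empty_left eventually_bot)
    show "eventually (\<lambda>y. y \<in> M) \<F>"
      unfolding ev by (intro exI[of _ "{}"]) auto
    fix \<U> assume "\<U> \<in> metric_uniformity"
    then obtain \<epsilon> where e: "\<epsilon> > 0" "refines {mball x \<epsilon> | x. x \<in> M} \<U>"
      and UM: "\<Union>\<U> = M"
      unfolding metric_uniformity_def by blast
    obtain a n where a: "a \<in> M" "\<not> finitely_covered \<G> ((small_steps \<epsilon> ^^ n) `` {a})"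
      using notfin[OF e(1)] by auto
    obtain U where U: "U \<in> \<U>" "a \<in> U" using UM a by blast
    show "\<exists>m. \<exists>U\<in>\<U>. \<forall>F. eventually (\<lambda>y. y \<in> F) \<F> \<longrightarrow> F \<inter> iter_star m U \<U> \<noteq> {}"
      using meets[OF _ a(2) chain_M[OF a(1)]]
        small_steps_iterate_subset_iter_star[OF e(2) U(2)] U(1) by blast
  qed
  then obtain x where x: "cluster_point_in mtopology \<F> x"
    using cbc unfolding cofinally_Bourbaki_complete_def by blast
  then obtain W where W: "W \<in> \<G>" "x \<in> W" "openin mtopology W"
    using G unfolding open_cover_of_def cluster_point_in_def by blast
  have "eventually (\<lambda>y. y \<in> M - W) \<F>"
    unfolding ev by (rule exI[of _ "{W}"]) (use W in auto)
  then show False using x W unfolding cluster_point_in_def by blast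
qed

text \<open>A filter without cluster points makes the open sets with complement in the filter a cover.
  For a refinement \<open>\<A>\<close> as in uniform strong paracompactness, taking stars with respect to the
  uniform cover preserves being covered by finitely many members of \<open>\<A>\<close>. Every iterated star
  is then disjoint from some member of the filter.\<close>

lemma uniformly_strongly_paracompact_imp_cofinally_Bourbaki_complete:
  assumes usp: uniformly_strongly_paracompact
  shows cofinally_Bourbaki_complete
  unfolding cofinally_Bourbaki_complete_def
proof (intro allI impI, rule ccontr)
  fix \<F> assume F: "cofinally_Bourbaki_Cauchy \<F>"
  assume neg: "\<nexists>x. cluster_point_in mtopology \<F> x"
  have FM: "eventually (\<lambda>y. y \<in> M) \<F>"
    using F unfolding cofinally_Bourbaki_Cauchy_def by blast
  define \<G> where "\<G> = {W. openin mtopology W \<and> eventually (\<lambda>y. y \<in> M - W) \<F>}"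
  have "open_cover_of mtopology \<G>"
    unfolding open_cover_of_def
  proof (intro conjI)
    show "\<Union>\<G> = topspace mtopology"
    proof
      show "\<Union>\<G> \<subseteq> topspace mtopology" unfolding \<G>_def using openin_subset by blast
      show "topspace mtopology \<subseteq> \<Union>\<G>"
      proof
        fix x assume "x \<in> topspace mtopology"
        with neg obtain W F where W: "openin mtopology W" "x \<in> W" "F \<inter> W = {}"
          and ev: "eventually (\<lambda>y. y \<in> F) \<F>"
          unfolding cluster_point_in_def by blast
        have "eventually (\<lambda>y. y \<in> M - W) \<F>"
          using eventually_conj[OF ev FM] by eventually_elim (use W in auto)
        then show "x \<in> \<Union>\<G>" unfolding \<G>_def using W by blast
      qed
    qed
  qed (auto simp: \<G>_def)
  then obtain \<A> \<U> where A: "open_cover_of mtopology \<A>" "refines \<A> \<G>"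
    and U: "\<U> \<in> metric_uniformity"
    and fin: "\<And>A. A \<in> \<A> \<Longrightarrow> finite {A' \<in> \<A>. star A \<U> \<inter> A' \<noteq> {}}"
    using usp unfolding uniformly_strongly_paracompact_def by metis
  have UA: "\<Union>\<A> = M" using A unfolding open_cover_of_def by simp
  have UM: "\<Union>\<U> = M" using U unfolding metric_uniformity_def by blast
  have star_covered: "finitely_covered \<A> (star S \<U>)" if "finitely_covered \<A> S" for S
  proof -
    obtain \<H> where H: "\<H> \<subseteq> \<A>" "finite \<H>" "S \<subseteq> \<Union>\<H>"
      using \<open>finitely_covered \<A> S\<close> unfolding finitely_covered_def by blast
    have "finitely_covered \<A> (\<Union>A\<in>\<H>. star A \<U>)"
    proof (rule finitely_covered_UN[OF H(2)])
      fix A assume "A \<in> \<H>"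
      then have *: "finite {A' \<in> \<A>. star A \<U> \<inter> A' \<noteq> {}}" using fin H by blast
      have "star A \<U> \<subseteq> M" using UM unfolding star_def by blast
      then have "star A \<U> \<subseteq> \<Union>{A' \<in> \<A>. star A \<U> \<inter> A' \<noteq> {}}" using UA by blast
      then show "finitely_covered \<A> (star A \<U>)"
        unfolding finitely_covered_def using *
        by (intro exI[of _ "{A' \<in> \<A>. star A \<U> \<inter> A' \<noteq> {}}"]) auto
    qed
    moreover have "star S \<U> \<subseteq> (\<Union>A\<in>\<H>. star A \<U>)" using H(3) unfolding star_def by blast
    ultimately show ?thesis by (rule finitely_covered_subset)
  qed
  obtain m V where V: "V \<in> \<U>"
    and meets: "\<And>F. eventually (\<lambda>y. y \<in> F) \<F> \<Longrightarrow> F \<inter> iter_star m V \<U> \<noteq> {}"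
    using F U unfolding cofinally_Bourbaki_Cauchy_def by blast
  have "finitely_covered \<A> V"
  proof (cases "V = {}")
    case False
    then obtain x A where "x \<in> V" "A \<in> \<A>" "x \<in> A" using UA UM V by blast
    then have "V \<subseteq> star A \<U>" "finitely_covered \<A> A"
      using V unfolding star_def finitely_covered_def by (blast, intro exI[of _ "{A}"], simp)
    then show ?thesis using star_covered finitely_covered_subset by blast
  qed (auto simp: finitely_covered_def)
  then have "finitely_covered \<A> (iter_star m V \<U>)"
    by (induction m) (auto intro: star_covered)
  then obtain \<H> where H: "\<H> \<subseteq> \<A>" "finite \<H>" "iter_star m V \<U> \<subseteq> \<Union>\<H>"
    unfolding finitely_covered_def by blast
  have "eventually (\<lambda>y. y \<in> M - A) \<F>" if A': "A \<in> \<H>" for A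
  proof -
    obtain G where "G \<in> \<G>" "A \<subseteq> G" using A' H A(2) unfolding refines_def by blast
    then show ?thesis unfolding \<G>_def by (auto elim: eventually_mono)
  qed
  then have "eventually (\<lambda>y. \<forall>A\<in>\<H>. y \<in> M - A) \<F>"
    using H(2) by (simp add: eventually_ball_finite_distrib)
  then have "eventually (\<lambda>y. y \<in> {y. \<forall>A\<in>\<H>. y \<in> M - A}) \<F>" by simp
  from meets[OF this] show False using H(3) by auto
qed

text \<open>Each \<open>\<epsilon>\<close>-chain component gets a base point \<open>c x\<close>, and \<open>r x\<close> is the least number of
  steps from it to \<open>x\<close>. Points at distance less than \<open>\<epsilon>\<close> lie in the same component, at chain
  distances that differ by at most one (the bound on \<open>r y\<close> applies with \<open>x\<close> and \<open>y\<close>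
  exchanged).\<close>

lemma chain_distance:
  obtains c :: "'a \<Rightarrow> 'a" and r :: "'a \<Rightarrow> nat"
  where "\<And>x. x \<in> M \<Longrightarrow> c x \<in> M \<and> x \<in> (small_steps \<epsilon> ^^ r x) `` {c x}"
    and "\<And>x y. x \<in> M \<Longrightarrow> y \<in> M \<Longrightarrow> d x y < \<epsilon> \<Longrightarrow> c x = c y \<and> r y \<le> Suc (r x)"
proof -
  let ?R = "small_steps \<epsilon>"
  define c where "c x = (SOME y. (y, x) \<in> ?R\<^sup>*)" for x
  define r where "r x = (LEAST n. (c x, x) \<in> ?R ^^ n)" for x
  have c: "(c x, x) \<in> ?R\<^sup>*" for x
    unfolding c_def by (rule someI[of _ x]) simp
  have r: "(c x, x) \<in> ?R ^^ r x" for x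
    unfolding r_def using c[of x] by (metis LeastI rtrancl_imp_relpow)
  have 1: "c x \<in> M \<and> x \<in> (?R ^^ r x) `` {c x}" if "x \<in> M" for x
  proof -
    have "c x \<in> M" using c[of x] that
      by (induction rule: converse_rtrancl_induct) (auto simp: small_steps_def)
    then show ?thesis using r by auto
  qed
  have 2: "c x = c y \<and> r y \<le> Suc (r x)" if "x \<in> M" "y \<in> M" "d x y < \<epsilon>" for x y
  proof -
    have xy: "(x, y) \<in> ?R" "(y, x) \<in> ?R" using that by (auto simp: small_steps_def commute)
    then have "(z, x) \<in> ?R\<^sup>* \<longleftrightarrow> (z, y) \<in> ?R\<^sup>*" for z
      by (meson rtrancl.rtrancl_into_rtrancl)
    then have cc: "c x = c y" unfolding c_def by simp
    have "(c y, y) \<in> ?R ^^ Suc (r x)" using r[of x] xy cc by auto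
    then have "r y \<le> Suc (r x)" unfolding r_def[of y] by (rule Least_le)
    with cc show ?thesis by simp
  qed
  show thesis using that 1 2 by blast
qed

text \<open>The refinement consists of the thin neighbourhoods \<open>W a n\<close> of the layers of points at chain
  distance \<open>n\<close> from the base point \<open>a\<close>, each cut up by finitely many members of \<open>\<G>\<close>.
  Small stars only reach adjacent layers of the same component.\<close>

lemma chain_covering_imp_uniformly_strongly_paracompact:
  assumes chain_covering
  shows uniformly_strongly_paracompact
  unfolding uniformly_strongly_paracompact_def
proof (intro allI impI)
  fix \<G> assume G: "open_cover_of mtopology \<G>"
  then obtain \<epsilon> where "\<epsilon> > 0"
    and cov: "\<And>a n. a \<in> M \<Longrightarrow> finitely_covered \<G> ((small_steps \<epsilon> ^^ n) `` {a})"
    using assms unfolding chain_covering_def by metis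
  obtain c r where cr: "\<And>x. x \<in> M \<Longrightarrow> c x \<in> M \<and> x \<in> (small_steps \<epsilon> ^^ r x) `` {c x}"
    and step: "\<And>x y. x \<in> M \<Longrightarrow> y \<in> M \<Longrightarrow> d x y < \<epsilon> \<Longrightarrow> c x = c y \<and> r y \<le> Suc (r x)"
    using chain_distance[of \<epsilon>] by blast
  \<comment> \<open>The radius is a quarter of the scale: two layers whose neighbourhoods meet a common ball of
    radius \<open>\<epsilon>/4\<close> contain points at distance less than \<open>4 * (\<epsilon>/4)\<close>.\<close>
  define W where "W a n = (\<Union>y\<in>{y\<in>M. c y = a \<and> r y = n}. mball y (\<epsilon>/4))" for a n
  have W_open: "openin mtopology (W a n)" for a n
    unfolding W_def by (intro openin_Union) auto
  have "finitely_covered \<G> (W a n)" if "a \<in> M" for a n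
  proof (rule finitely_covered_subset)
    show "finitely_covered \<G> (\<Union>k\<in>{..Suc n}. (small_steps \<epsilon> ^^ k) `` {a})"
      by (rule finitely_covered_UN) (use cov that in auto)
    show "W a n \<subseteq> (\<Union>k\<in>{..Suc n}. (small_steps \<epsilon> ^^ k) `` {a})"
    proof
      fix x assume "x \<in> W a n"
      then obtain y where "y \<in> M" "x \<in> M" "c y = a" "r y = n" "d y x < \<epsilon>/4"
        unfolding W_def by auto
      then show "x \<in> (\<Union>k\<in>{..Suc n}. (small_steps \<epsilon> ^^ k) `` {a})"
        using step[of y x] cr[of x] \<open>\<epsilon> > 0\<close> by auto
    qed
  qed
  then obtain H where H: "\<And>a n. a \<in> M \<Longrightarrow> H a n \<subseteq> \<G> \<and> finite (H a n) \<and> W a n \<subseteq> \<Union>(H a n)"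
    unfolding finitely_covered_def by metis
  define layer where "layer a n = {W a n \<inter> G | G. G \<in> H a n}" for a n
  define \<A> where "\<A> = (\<Union>a\<in>M. \<Union>n. layer a n)"
  define \<U> where "\<U> = {mball x (\<epsilon>/4) | x. x \<in> M}"
  have layer_fin: "finite (layer a n)" if "a \<in> M" for a n
    unfolding layer_def using H that by simp
  have self_W: "x \<in> W (c x) (r x)" if "x \<in> M" for x
    unfolding W_def using that \<open>\<epsilon> > 0\<close> by auto
  show "\<exists>\<A>. open_cover_of mtopology \<A> \<and> refines \<A> \<G> \<and>
           (\<exists>\<U>\<in>metric_uniformity. \<forall>A\<in>\<A>. finite {A' \<in> \<A>. star A \<U> \<inter> A' \<noteq> {}})"
  proof (intro exI[of _ \<A>] conjI bexI[of _ \<U>] ballI)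
    show "open_cover_of mtopology \<A>"
      unfolding open_cover_of_def
    proof (intro conjI ballI)
      fix A assume "A \<in> \<A>"
      then obtain a n G where "a \<in> M" "A = W a n \<inter> G" "G \<in> H a n"
        unfolding \<A>_def layer_def by blast
      then show "openin mtopology A"
        using W_open H G unfolding open_cover_of_def by (metis openin_Int subsetD)
    next
      have "x \<in> \<Union>\<A>" if "x \<in> M" for x
        unfolding \<A>_def layer_def using that self_W[OF that] cr[OF that] H[of "c x" "r x"] by blast
      moreover have "W a n \<subseteq> M" for a n unfolding W_def by auto
      ultimately show "\<Union>\<A> = topspace mtopology"
        unfolding \<A>_def layer_def by auto
    qed
    show "refines \<A> \<G>"
      unfolding refines_def \<A>_def layer_def using H by blast
    show "\<U> \<in> metric_uniformity"
      unfolding metric_uniformity_def \<U>_def refines_def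
      using \<open>\<epsilon> > 0\<close> by (auto intro!: exI[of _ "\<epsilon>/4"] bexI[of _ x for x])
    fix A assume "A \<in> \<A>"
    then obtain a n where a: "a \<in> M" "A \<subseteq> W a n"
      unfolding \<A>_def layer_def by blast
    have "{A' \<in> \<A>. star A \<U> \<inter> A' \<noteq> {}} \<subseteq> (\<Union>k\<in>{..Suc n}. layer a k)"
    proof clarify
      fix A' assume "A' \<in> \<A>" "star A \<U> \<inter> A' \<noteq> {}"
      then obtain b k w' where b: "b \<in> M" "A' \<in> layer b k" "A' \<subseteq> W b k"
        and w': "w' \<in> A'" "w' \<in> star A \<U>"
        unfolding \<A>_def layer_def by blast
      then obtain w z where w: "w \<in> A" "z \<in> M" "w \<in> mball z (\<epsilon>/4)" "w' \<in> mball z (\<epsilon>/4)"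
        unfolding star_def \<U>_def by blast
      obtain y y' where y: "y \<in> M" "c y = a" "r y = n" "w \<in> mball y (\<epsilon>/4)"
        and y': "y' \<in> M" "c y' = b" "r y' = k" "w' \<in> mball y' (\<epsilon>/4)"
        using w(1) a(2) w'(1) b(3) unfolding W_def by blast
      have "d y y' < \<epsilon>"
        using w(2-4) y(1,4) y'(1,4) triangle[of y w y'] triangle[of w z y'] triangle[of z w' y']
        by (auto simp: commute)
      then have "a = b" "k \<le> Suc n" using step[of y y'] y y' by auto
      then show "A' \<in> (\<Union>k\<in>{..Suc n}. layer a k)" using b by blast
    qed
    moreover have "finite (\<Union>k\<in>{..Suc n}. layer a k)" using layer_fin a by blast
    ultimately show "finite {A' \<in> \<A>. star A \<U> \<inter> A' \<noteq> {}}" by (rule finite_subset)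
  qed
qed

lemma cofinally_Bourbaki_complete_iff_uniformly_strongly_paracompact:
  "cofinally_Bourbaki_complete \<longleftrightarrow> uniformly_strongly_paracompact"
  using cofinally_Bourbaki_complete_imp_chain_covering
    chain_covering_imp_uniformly_strongly_paracompact
    uniformly_strongly_paracompact_imp_cofinally_Bourbaki_complete by blast

lemma uniformly_strongly_paracompact_imp_strongly_paracompact:
  assumes uniformly_strongly_paracompact
  shows "strongly_paracompact mtopology"
  unfolding strongly_paracompact_def
proof (intro allI impI)
  fix \<G> assume "open_cover_of mtopology \<G>"
  then obtain \<A> \<U> where A: "open_cover_of mtopology \<A>" "refines \<A> \<G>" "\<U> \<in> metric_uniformity"
    and fin: "\<And>A. A \<in> \<A> \<Longrightarrow> finite {A' \<in> \<A>. star A \<U> \<inter> A' \<noteq> {}}"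
    using assms unfolding uniformly_strongly_paracompact_def by metis
  have "star_finite \<A>"
    unfolding star_finite_def
  proof
    fix A assume "A \<in> \<A>"
    then have "A \<subseteq> star A \<U>"
      using A unfolding open_cover_of_def metric_uniformity_def
      by (intro subset_star) auto
    then have "{B \<in> \<A>. A \<inter> B \<noteq> {}} \<subseteq> {A' \<in> \<A>. star A \<U> \<inter> A' \<noteq> {}}" by blast
    then show "finite {B \<in> \<A>. A \<inter> B \<noteq> {}}"
      using fin[OF \<open>A \<in> \<A>\<close>] by (rule finite_subset)
  qed
  then show "\<exists>\<A>. open_cover_of mtopology \<A> \<and> refines \<A> \<G> \<and> star_finite \<A>"
    using A by blast
qed

section \<open>Compactness of the set of non-local compactness\<close>

lemma closedin_nlc: "closedin mtopology (nlc mtopology)"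
proof -
  have "M - nlc mtopology = \<Union>{U. openin mtopology U \<and> (\<exists>K. compactin mtopology K \<and> U \<subseteq> K)}"
    unfolding nlc_def using openin_subset by fastforce
  then show ?thesis
    unfolding closedin_def nlc_def by auto
qed

text \<open>An empty derived set expresses that a set is closed and discrete.\<close>

lemma nlc_mcball_infinite_discrete:
  assumes "x \<in> nlc mtopology" "r > 0"
  obtains Y where "infinite Y" "Y \<subseteq> mcball x r" "mtopology derived_set_of Y = {}"
proof -
  have "\<not> compactin mtopology (mcball x r)"
    using assms unfolding nlc_def
    by (smt (verit) centre_in_mball_iff mball_subset_mcball mem_Collect_eq openin_mball topspace_mtopology)
  then obtain Y where Y: "Y \<subseteq> mcball x r" "infinite Y" "mcball x r \<inter> mtopology derived_set_of Y = {}"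
    unfolding compactin_eq_Bolzano_Weierstrass using mcball_subset_mspace by blast
  have "mtopology derived_set_of Y \<subseteq> mcball x r"
    using Y(1) by (meson closedin_mcball closedin_contains_derived_set derived_set_of_mono subset_trans)
  then show thesis using that Y by blast
qed

text \<open>Closed discrete sets \<open>Y n\<close> in balls of radii tending to \<open>0\<close> around an injective closed
  discrete sequence have a closed discrete union: near a given point only finitely many of them
  occur.\<close>

lemma derived_set_of_UN_empty:
  assumes Y: "\<And>n::nat. mtopology derived_set_of (Y n) = {}"
    and sub: "\<And>n. Y n \<subseteq> mcball (x n) (1 / Suc n)"
    and "inj x" and x: "mtopology derived_set_of (range x) = {}"
  shows "mtopology derived_set_of (\<Union>n. Y n) = {}"
proof (rule ccontr)
  assume "mtopology derived_set_of (\<Union>n. Y n) \<noteq> {}"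
  then obtain z where z: "z \<in> M" and zU: "\<And>U. z \<in> U \<Longrightarrow> openin mtopology U \<Longrightarrow> infinite ((\<Union>n. Y n) \<inter> U)"
    unfolding derived_set_of_infinite_openin_metric by auto
  obtain \<delta> where \<delta>: "\<delta> > 0" "finite (range x \<inter> mball z \<delta>)"
    using x z unfolding derived_set_of_infinite_mball by blast
  have fin1: "finite {n. x n \<in> mball z \<delta>}"
  proof -
    have "{n. x n \<in> mball z \<delta>} = x -` (range x \<inter> mball z \<delta>)" by auto
    then show ?thesis using finite_vimageI[OF \<delta>(2) \<open>inj x\<close>] by metis
  qed
  obtain N where N: "1 / Suc N < \<delta>/2" using \<delta>(1) nat_approx_posE[of "\<delta>/2"] by auto
  define I where "I = {n. x n \<in> mball z \<delta>} \<union> {..N}"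
  have "finite I" using fin1 unfolding I_def by simp
  have far: "Y n \<inter> mball z (\<delta>/2) = {}" if "n \<notin> I" for n
  proof (rule ccontr)
    assume "Y n \<inter> mball z (\<delta>/2) \<noteq> {}"
    then obtain y where y: "y \<in> Y n" "y \<in> mball z (\<delta>/2)" by blast
    then have y': "x n \<in> M" "y \<in> M" "d (x n) y \<le> 1 / Suc n" "d z y < \<delta>/2" using sub[of n] by auto
    have "1 / Suc n \<le> 1 / Suc N" using that unfolding I_def by (simp add: frac_le)
    then have "d z (x n) < \<delta>" using triangle[of z y "x n"] y' z N by (simp add: commute)
    then show False using that y' z unfolding I_def by simp
  qed
  have "\<exists>U. z \<in> U \<and> openin mtopology U \<and> finite (Y n \<inter> U)" for n
    using Y[of n] z unfolding derived_set_of_infinite_openin_metric by blast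
  then obtain U where U: "\<And>n. z \<in> U n \<and> openin mtopology (U n) \<and> finite (Y n \<inter> U n)"
    by metis
  define V where "V = mball z (\<delta>/2) \<inter> (\<Inter>n\<in>insert 0 I. U n)"
  have "openin mtopology (\<Inter>n\<in>insert 0 I. U n)"
    by (rule openin_INT2) (use U \<open>finite I\<close> in auto)
  then have "openin mtopology V" unfolding V_def by (intro openin_Int) auto
  moreover have "z \<in> V" unfolding V_def using U z \<delta>(1) by auto
  ultimately have "infinite ((\<Union>n. Y n) \<inter> V)" using zU by blast
  moreover have "(\<Union>n. Y n) \<inter> V \<subseteq> (\<Union>n\<in>I. Y n \<inter> U n)"
    using far unfolding V_def by blast
  moreover have "finite (\<Union>n\<in>I. Y n \<inter> U n)" using U \<open>finite I\<close> by blast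
  ultimately show False using finite_subset by blast
qed

text \<open>Otherwise there is a closed discrete sequence in \<open>nlc\<close>, and the closed ball of radius \<open>1/(n+1)\<close>
  around its \<open>n\<close>-th term contains an infinite closed discrete set \<open>Y n\<close>. The open sets that
  meet the union of the \<open>Y n\<close> in finite sets form a cover, and no ball of radius greater than
  \<open>1/(n+1)\<close> around the \<open>n\<close>-th term is covered by finitely many of them. Chains with a single
  step suffice for the contradiction.\<close>

lemma chain_covering_imp_compactin_nlc:
  assumes chain_covering
  shows "compactin mtopology (nlc mtopology)"
proof (rule ccontr)
  assume nc: "\<not> compactin mtopology (nlc mtopology)"
  have "nlc mtopology \<subseteq> M" unfolding nlc_def by auto
  with nc obtain T where T: "T \<subseteq> nlc mtopology" "infinite T"
      "nlc mtopology \<inter> mtopology derived_set_of T = {}"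
    unfolding compactin_eq_Bolzano_Weierstrass by blast
  have "mtopology derived_set_of T \<subseteq> nlc mtopology"
    using T(1) by (meson closedin_nlc closedin_contains_derived_set derived_set_of_mono subset_trans)
  then have T': "mtopology derived_set_of T = {}" using T(3) by blast
  obtain x :: "nat \<Rightarrow> 'a" where x: "inj x" "range x \<subseteq> T"
    using infinite_countable_subset[OF T(2)] by blast
  have "mtopology derived_set_of (range x) = {}"
    using derived_set_of_mono[OF x(2)] T' by blast
  have "\<exists>Y. infinite Y \<and> Y \<subseteq> mcball (x n) (1 / Suc n) \<and> mtopology derived_set_of Y = {}" for n
  proof -
    have "x n \<in> nlc mtopology" using x T by blast
    then show ?thesis
      by (rule nlc_mcball_infinite_discrete[of _ "1 / Suc n"]) auto
  qed
  then obtain Y where Y: "\<And>n. infinite (Y n)" "\<And>n. Y n \<subseteq> mcball (x n) (1 / Suc n)"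
    "\<And>n. mtopology derived_set_of (Y n) = {}" by metis
  have D: "mtopology derived_set_of (\<Union>n. Y n) = {}"
    by (rule derived_set_of_UN_empty) (fact Y x \<open>mtopology derived_set_of (range x) = {}\<close>)+
  define \<G> where "\<G> = {U. openin mtopology U \<and> finite ((\<Union>n. Y n) \<inter> U)}"
  have "open_cover_of mtopology \<G>"
    using D openin_subset unfolding open_cover_of_def \<G>_def derived_set_of_infinite_openin_metric
    by fastforce
  then obtain \<epsilon> where e: "\<epsilon> > 0" "\<And>a n. a \<in> M \<Longrightarrow> finitely_covered \<G> ((small_steps \<epsilon> ^^ n) `` {a})"
    using assms unfolding chain_covering_def by metis
  obtain n where n: "1 / Suc n < \<epsilon>" using nat_approx_posE[OF e(1)] by auto
  have xM: "x n \<in> M" using x T unfolding nlc_def by auto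
  have "Y n \<subseteq> (small_steps \<epsilon> ^^ 1) `` {x n}"
    using Y(2)[of n] n by (auto simp: small_steps_def)
  then have "finitely_covered \<G> (Y n)" using e(2)[OF xM] finitely_covered_subset by blast
  then obtain \<H> where H: "\<H> \<subseteq> \<G>" "finite \<H>" "Y n \<subseteq> \<Union>\<H>"
    unfolding finitely_covered_def by blast
  have "finite (\<Union>U\<in>\<H>. (\<Union>n. Y n) \<inter> U)"
    by (rule finite_UN_I) (use H in \<open>auto simp: \<G>_def\<close>)
  moreover have "Y n \<subseteq> (\<Union>U\<in>\<H>. (\<Union>n. Y n) \<inter> U)"
  proof
    fix y assume "y \<in> Y n"
    moreover from this obtain U where "U \<in> \<H>" "y \<in> U" using H(3) by blast
    ultimately show "y \<in> (\<Union>U\<in>\<H>. (\<Union>n. Y n) \<inter> U)" by blast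
  qed
  ultimately show False using Y(1) finite_subset by blast
qed

section \<open>Metrics with prescribed uniform covers\<close>

text \<open>A pointwise equicontinuous family of functions into \<open>[0, 1]\<close> becomes uniformly
  equicontinuous after adding the supremum of the differences \<open>\<bar>h i x - h i y\<bar>\<close> to the metric,
  and the topology stays the same. The bounds on \<open>h\<close> are required off \<open>M\<close> as well, since a
  metric in the sense of \<^locale>\<open>Metric_space\<close> is nonnegative on the whole type.\<close>

lemma metric_making_family_uniform:
  fixes h :: "'i \<Rightarrow> 'a \<Rightarrow> real"
  assumes range: "\<And>i x. 0 \<le> h i x \<and> h i x \<le> 1"
    and equi: "\<And>x e. x \<in> M \<Longrightarrow> e > 0 \<Longrightarrow>
      \<exists>\<delta>>0. \<forall>y\<in>M. d x y < \<delta> \<longrightarrow> (\<forall>i\<in>I. \<bar>h i x - h i y\<bar> \<le> e)"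
  obtains d' where "Metric_space M d'" "Metric_space.mtopology M d' = mtopology"
    and "\<And>i x y. i \<in> I \<Longrightarrow> \<bar>h i x - h i y\<bar> \<le> d' x y"
proof -
  \<comment> \<open>The element \<open>0\<close> only matters when \<open>I\<close> is empty.\<close>
  define D where "D x y = insert 0 ((\<lambda>i. \<bar>h i x - h i y\<bar>) ` I)" for x y
  define s where "s x y = Sup (D x y)" for x y
  define d' where "d' x y = d x y + s x y" for x y
  have "\<bar>h i x - h i y\<bar> \<le> 1" for i x y using range[of i x] range[of i y] by auto
  then have bdd: "bdd_above (D x y)" for x y
    unfolding D_def by (intro bdd_aboveI[of _ 1]) auto
  have s_nonneg: "0 \<le> s x y" for x y
    unfolding s_def by (rule cSup_upper[OF _ bdd]) (simp add: D_def)
  have s_upper: "\<bar>h i x - h i y\<bar> \<le> s x y" if "i \<in> I" for i x y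
    unfolding s_def by (rule cSup_upper[OF _ bdd]) (use that in \<open>simp add: D_def\<close>)
  have s_least: "s x y \<le> e" if "0 \<le> e" "\<And>i. i \<in> I \<Longrightarrow> \<bar>h i x - h i y\<bar> \<le> e" for x y e
    unfolding s_def by (rule cSup_least) (use that in \<open>auto simp: D_def\<close>)
  have s_tri: "s x z \<le> s x y + s y z" for x y z
  proof (rule s_least)
    show "0 \<le> s x y + s y z" using s_nonneg by (simp add: add_nonneg_nonneg)
    show "\<bar>h i x - h i z\<bar> \<le> s x y + s y z" if "i \<in> I" for i
      using s_upper[OF that, of x y] s_upper[OF that, of y z] by linarith
  qed
  have s_comm: "s x y = s y x" for x y
    unfolding s_def D_def by (simp add: abs_minus_commute)
  have s_refl: "s x x = 0" for x
    using s_least[of 0 x x] s_nonneg[of x x] by auto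
  interpret D': Metric_space M d'
  proof
    fix x y z
    show "0 \<le> d' x y" using s_nonneg by (simp add: d'_def add_nonneg_nonneg)
    show "d' x y = d' y x" by (simp add: d'_def s_comm commute)
    show "d' x y = 0 \<longleftrightarrow> x = y" if "x \<in> M" "y \<in> M"
      using that s_nonneg[of x y] nonneg[of x y] zero[of x y] s_refl unfolding d'_def
      by (smt (verit))
    show "d' x z \<le> d' x y + d' y z" if "x \<in> M" "y \<in> M" "z \<in> M"
      using triangle[of x y z] that s_tri[of x z y] by (simp add: d'_def)
  qed
  have ball1: "D'.mball x r \<subseteq> mball x r" for x r
    using s_nonneg by (auto simp: d'_def) (smt (verit))
  have ball2: "\<exists>\<delta>>0. mball x \<delta> \<subseteq> D'.mball x r" if x: "x \<in> M" and r: "r > 0" for x r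
  proof -
    obtain \<delta> where \<delta>: "\<delta> > 0" "\<And>y. y \<in> M \<Longrightarrow> d x y < \<delta> \<Longrightarrow> \<forall>i\<in>I. \<bar>h i x - h i y\<bar> \<le> r/2"
      using equi[of x "r/2"] x r by auto
    have "d' x y < r" if "y \<in> M" "d x y < min \<delta> (r/2)" for y
      using s_least[of "r/2" x y] \<delta>(2)[of y] that \<open>r > 0\<close> by (simp add: d'_def)
    then show ?thesis using \<delta>(1) that by (intro exI[of _ "min \<delta> (r/2)"]) auto
  qed
  have "openin D'.mtopology U \<longleftrightarrow> openin mtopology U" for U
    unfolding openin_mtopology D'.openin_mtopology
    using ball1 ball2 by (meson subset_iff subset_trans)
  then have "D'.mtopology = mtopology" by (simp add: topology_eq)
  moreover have "\<bar>h i x - h i y\<bar> \<le> d' x y" if "i \<in> I" for i x y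
    using s_upper[OF that, of x y] nonneg[of x y] unfolding d'_def by linarith
  ultimately show thesis using that D'.Metric_space_axioms by blast
qed

text \<open>The distance to the complement of \<open>A\<close>, truncated at \<open>1\<close>; the truncation also gives the
  value \<open>1\<close> when the complement is empty.\<close>

lemma distance_to_complement:
  obtains f :: "'a set \<Rightarrow> 'a \<Rightarrow> real"
  where "\<And>A x. 0 \<le> f A x \<and> f A x \<le> 1"
    and "\<And>A x. x \<in> M \<Longrightarrow> 0 < f A x \<Longrightarrow> x \<in> A"
    and "\<And>A x. openin mtopology A \<Longrightarrow> x \<in> A \<Longrightarrow> 0 < f A x"
    and "\<And>A x y. x \<in> M \<Longrightarrow> y \<in> M \<Longrightarrow> f A x \<le> f A y + d x y"
proof -
  define f where "f A x = Inf (insert 1 (d x ` (M - A)))" for A x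
  have bdd: "bdd_below (insert 1 (d x ` (M - A)))" for A x
    by (rule bdd_belowI[of _ 0]) auto
  have lower: "f A x \<le> t" if "t \<in> insert 1 (d x ` (M - A))" for A x t
    unfolding f_def by (rule cInf_lower[OF that bdd])
  have greatest: "t \<le> f A x" if "t \<le> 1" "\<And>z. z \<in> M \<Longrightarrow> z \<notin> A \<Longrightarrow> t \<le> d x z" for A x t
    unfolding f_def by (rule cInf_greatest) (use that in auto)
  show thesis
  proof
    show "0 \<le> f A x \<and> f A x \<le> 1" for A x using lower greatest by auto
    show "x \<in> A" if "x \<in> M" "0 < f A x" for A x
      using lower[of "d x x" x A] that by force
    show "0 < f A x" if A: "openin mtopology A" "x \<in> A" for A x
    proof -
      obtain r where r: "r > 0" "mball x r \<subseteq> A" "x \<in> M"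
        using A unfolding openin_mtopology by blast
      have "min 1 r \<le> f A x" by (rule greatest) (use r in force)+
      then show ?thesis using r(1) by linarith
    qed
    show "f A x \<le> f A y + d x y" if xy: "x \<in> M" "y \<in> M" for A x y
    proof -
      have "f A x - d x y \<le> f A y"
      proof (rule greatest)
        show "f A x - d x y \<le> 1" using lower[of 1 x A, OF insertI1] nonneg[of x y] by linarith
        show "f A x - d x y \<le> d y z" if "z \<in> M" "z \<notin> A" for z
          using lower[of "d x z" x A] triangle[of x y z] that xy by force
      qed
      then show ?thesis by simp
    qed
  qed
qed

text \<open>The functions are the truncated distances to the complements of the members of the cover,
  divided by their pointwise supremum \<open>l\<close>. After this normalisation the supremum is \<open>1\<close>
  everywhere, hence the uniform bound \<open>1/2\<close>; the Lipschitz constant \<open>2 / l x\<close> depends on the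
  point \<open>x\<close> but not on the member of the cover.\<close>

lemma open_cover_separating_functions:
  assumes cover: "open_cover_of mtopology \<A>"
  obtains g :: "'a set \<Rightarrow> 'a \<Rightarrow> real"
  where "\<And>A x. A \<in> \<A> \<Longrightarrow> x \<in> M \<Longrightarrow> 0 \<le> g A x \<and> g A x \<le> 1"
    and "\<And>A x. A \<in> \<A> \<Longrightarrow> x \<in> M \<Longrightarrow> 0 < g A x \<Longrightarrow> x \<in> A"
    and "\<And>x. x \<in> M \<Longrightarrow> \<exists>A\<in>\<A>. 1/2 < g A x"
    and "\<And>x. x \<in> M \<Longrightarrow> \<exists>L\<ge>0. \<forall>y\<in>M. \<forall>A\<in>\<A>. \<bar>g A x - g A y\<bar> \<le> L * d x y"
proof -
  obtain f :: "'a set \<Rightarrow> 'a \<Rightarrow> real" where f01: "\<And>A x. 0 \<le> f A x \<and> f A x \<le> 1"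
    and f_in: "\<And>A x. x \<in> M \<Longrightarrow> 0 < f A x \<Longrightarrow> x \<in> A"
    and f_pos: "\<And>A x. openin mtopology A \<Longrightarrow> x \<in> A \<Longrightarrow> 0 < f A x"
    and f_lip: "\<And>A x y. x \<in> M \<Longrightarrow> y \<in> M \<Longrightarrow> f A x \<le> f A y + d x y"
    by (rule distance_to_complement) blast
  define l where "l x = (SUP A\<in>\<A>. f A x)" for x
  have f_le: "f A x \<le> l x" if "A \<in> \<A>" for A x
    unfolding l_def by (rule cSUP_upper[OF that]) (use f01 in \<open>auto intro!: bdd_aboveI[of _ 1]\<close>)
  have l_pos: "0 < l x" if x: "x \<in> M" for x
  proof -
    obtain A where "A \<in> \<A>" "x \<in> A" "openin mtopology A"
      using x cover unfolding open_cover_of_def by auto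
    then show ?thesis using f_pos f_le by (meson less_le_trans)
  qed
  have nonempty: "\<A> \<noteq> {}" if "x \<in> M" for x
    using that cover unfolding open_cover_of_def by auto
  have l_lip: "l x \<le> l y + d x y" if xy: "x \<in> M" "y \<in> M" for x y
    unfolding l_def[of x]
  proof (rule cSUP_least)
    show "f A x \<le> l y + d x y" if "A \<in> \<A>" for A
      using f_lip[OF xy, of A] f_le[OF that, of y] by linarith
  qed (use nonempty xy in auto)
  define g where "g A x = f A x / l x" for A x
  show thesis
  proof
    fix A x assume A: "A \<in> \<A>" and x: "x \<in> M"
    show "0 \<le> g A x \<and> g A x \<le> 1"
      unfolding g_def using f01[of A x] f_le[OF A, of x] l_pos[OF x] by simp
    show "x \<in> A" if "0 < g A x"
      using that f_in[OF x, of A] l_pos[OF x] unfolding g_def by (simp add: zero_less_divide_iff)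
  next
    fix x assume x: "x \<in> M"
    have "l x / 2 < l x" using l_pos[OF x] by simp
    then obtain A where A: "A \<in> \<A>" "l x / 2 < f A x"
      unfolding l_def[of x] using less_cSUP_iff[of \<A> "\<lambda>A. f A x"] nonempty[OF x] f01
      by (metis (no_types, lifting) bdd_aboveI2)
    then have "1/2 < g A x" unfolding g_def using l_pos[OF x] by (simp add: field_simps)
    with A show "\<exists>A\<in>\<A>. 1/2 < g A x" by blast
  next
    fix x assume x: "x \<in> M"
    have "\<bar>g A x - g A y\<bar> \<le> 2 / l x * d x y" if y: "y \<in> M" and A: "A \<in> \<A>" for y A
    proof -
      have lx: "0 < l x" and ly: "0 < l y" using l_pos x y by auto
      have "g A x - g A y = ((f A x - f A y) + g A y * (l y - l x)) / l x"
        unfolding g_def using lx ly by (simp add: field_simps)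
      moreover have "\<bar>f A x - f A y\<bar> \<le> d x y"
        using f_lip[OF x y, of A] f_lip[OF y x, of A] by (simp add: commute abs_le_iff)
      moreover have "\<bar>g A y * (l y - l x)\<bar> \<le> 1 * d x y"
        unfolding abs_mult
      proof (rule mult_mono)
        show "\<bar>g A y\<bar> \<le> 1"
          unfolding g_def using f01[of A y] f_le[OF A, of y] ly by simp
        show "\<bar>l y - l x\<bar> \<le> d x y"
          using l_lip[OF x y] l_lip[OF y x] by (simp add: commute abs_le_iff)
      qed auto
      ultimately have "\<bar>g A x - g A y\<bar> \<le> (2 * d x y) / l x"
        using lx by (simp add: divide_right_mono)
      then show ?thesis by simp
    qed
    then show "\<exists>L\<ge>0. \<forall>y\<in>M. \<forall>A\<in>\<A>. \<bar>g A x - g A y\<bar> \<le> L * d x y"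
      using l_pos[OF x] by (intro exI[of _ "2 / l x"]) auto
  qed
qed

text \<open>For countably many open covers there is a compatible metric for which all of them are uniform
  covers. Multiplying the functions of the \<open>n\<close>-th cover by \<open>1 / 2 ^ n\<close> makes the whole family
  pointwise equicontinuous. If \<open>x\<close> and \<open>y\<close> are closer than \<open>1 / 2 ^ (n + 1)\<close> in the new
  metric, then a member of the \<open>n\<close>-th cover whose function exceeds \<open>1/2\<close> at \<open>x\<close> contains
  \<open>y\<close>.\<close>

lemma metric_with_Lebesgue_numbers:
  fixes \<A> :: "nat \<Rightarrow> 'a set set"
  assumes cover: "\<And>n. open_cover_of mtopology (\<A> n)"
  obtains d' where "Metric_space M d'" "Metric_space.mtopology M d' = mtopology"
    and "\<And>n. \<exists>\<epsilon>>0. \<forall>x\<in>M. \<exists>A\<in>\<A> n. \<forall>y\<in>M. d' x y < \<epsilon> \<longrightarrow> y \<in> A"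
proof -
  have "\<exists>g :: 'a set \<Rightarrow> 'a \<Rightarrow> real.
      (\<forall>A\<in>\<A> n. \<forall>x\<in>M. 0 \<le> g A x \<and> g A x \<le> 1 \<and> (0 < g A x \<longrightarrow> x \<in> A)) \<and>
      (\<forall>x\<in>M. \<exists>A\<in>\<A> n. 1/2 < g A x) \<and>
      (\<forall>x\<in>M. \<exists>L\<ge>0. \<forall>y\<in>M. \<forall>A\<in>\<A> n. \<bar>g A x - g A y\<bar> \<le> L * d x y)" for n
    by (rule open_cover_separating_functions[OF cover[of n]]) blast
  then obtain g :: "nat \<Rightarrow> 'a set \<Rightarrow> 'a \<Rightarrow> real" where
    g01: "\<And>n A x. A \<in> \<A> n \<Longrightarrow> x \<in> M \<Longrightarrow> 0 \<le> g n A x \<and> g n A x \<le> 1 \<and> (0 < g n A x \<longrightarrow> x \<in> A)"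
    and g_big: "\<And>n x. x \<in> M \<Longrightarrow> \<exists>A\<in>\<A> n. 1/2 < g n A x"
    and g_lip: "\<And>n x. x \<in> M \<Longrightarrow> \<exists>L\<ge>0. \<forall>y\<in>M. \<forall>A\<in>\<A> n. \<bar>g n A x - g n A y\<bar> \<le> L * d x y"
    by metis
  define I where "I = (SIGMA n:UNIV. \<A> n)"
  define h where "h i x = (if i \<in> I \<and> x \<in> M then g (fst i) (snd i) x / 2 ^ fst i else 0)" for i x
  have h_le: "0 \<le> h (n, A) x \<and> h (n, A) x \<le> (1/2) ^ n" for n A x
    using g01[of A n x] by (auto simp: h_def I_def power_divide divide_right_mono)
  obtain d' where d': "Metric_space M d'" "Metric_space.mtopology M d' = mtopology"
    and d'_ge: "\<And>i x y. i \<in> I \<Longrightarrow> \<bar>h i x - h i y\<bar> \<le> d' x y"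
  proof (rule metric_making_family_uniform[of h I])
    fix i :: "nat \<times> 'a set" and x
    have "(1/2::real) ^ fst i \<le> 1" by (rule power_le_one) auto
    then show "0 \<le> h i x \<and> h i x \<le> 1" using h_le[of "fst i" "snd i" x] by auto
  next
    fix x and e :: real assume x: "x \<in> M" and e: "e > 0"
    obtain N where N: "(1/2::real) ^ N < e" using real_arch_pow_inv[OF e, of "1/2"] by auto
    obtain L where L: "\<And>n. L n \<ge> 0" "\<And>n y A. y \<in> M \<Longrightarrow> A \<in> \<A> n \<Longrightarrow> \<bar>g n A x - g n A y\<bar> \<le> L n * d x y"
      using g_lip[OF x] by metis
    \<comment> \<open>A common Lipschitz constant at \<open>x\<close> for the first \<open>N\<close> covers; the added \<open>1\<close> makes it
      positive. The later covers contribute less than \<open>e\<close> in any case.\<close>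
    define K where "K = (\<Sum>n<N. L n) + 1"
    have K: "K > 0" "\<And>n. n < N \<Longrightarrow> L n \<le> K"
      unfolding K_def using L(1) by (auto intro!: add_nonneg_pos sum_nonneg add_increasing2 member_le_sum)
    have "\<bar>h i x - h i y\<bar> \<le> e" if y: "y \<in> M" "d x y < e / K" and i: "i \<in> I" for y i
    proof -
      obtain n A where [simp]: "i = (n, A)" by fastforce
      have A: "A \<in> \<A> n" using i by (simp add: I_def)
      show ?thesis
      proof (cases "n < N")
        case True
        have "\<bar>g n A x - g n A y\<bar> \<le> K * d x y"
          using L(2)[OF y(1) A] K(2)[OF True] by (meson mult_right_mono nonneg order_trans)
        also have "\<dots> \<le> e" using y(2) K(1) by (simp add: field_simps)
        finally have "\<bar>g n A x - g n A y\<bar> \<le> e" .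
        moreover have "\<bar>h i x - h i y\<bar> = \<bar>g n A x - g n A y\<bar> / 2 ^ n"
          using x y i by (simp add: h_def flip: diff_divide_distrib)
        moreover have "\<bar>g n A x - g n A y\<bar> / 2 ^ n \<le> \<bar>g n A x - g n A y\<bar> / 1"
          by (rule divide_left_mono) auto
        ultimately show ?thesis by simp
      next
        case False
        then have "(1/2::real) ^ n \<le> (1/2) ^ N" by (intro power_decreasing) auto
        moreover have "0 \<le> h i x" "h i x \<le> (1/2) ^ n" "0 \<le> h i y" "h i y \<le> (1/2) ^ n"
          using h_le by simp_all
        ultimately show ?thesis using N by linarith
      qed
    qed
    then show "\<exists>\<delta>>0. \<forall>y\<in>M. d x y < \<delta> \<longrightarrow> (\<forall>i\<in>I. \<bar>h i x - h i y\<bar> \<le> e)"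
      using e K(1) by (intro exI[of _ "e / K"]) auto
  qed blast
  have "\<forall>x\<in>M. \<exists>A\<in>\<A> n. \<forall>y\<in>M. d' x y < 1 / 2 / 2 ^ n \<longrightarrow> y \<in> A" for n
  proof
    fix x assume x: "x \<in> M"
    obtain A where A: "A \<in> \<A> n" "1/2 < g n A x" using g_big[OF x] by blast
    have "y \<in> A" if y: "y \<in> M" "d' x y < 1 / 2 / 2 ^ n" for y
    proof -
      have "\<bar>h (n, A) x - h (n, A) y\<bar> < 1 / 2 / 2 ^ n"
        using d'_ge[of "(n, A)" x y] A y by (simp add: I_def)
      then have "g n A x / 2 ^ n - g n A y / 2 ^ n < 1 / 2 / 2 ^ n"
        using A x y by (simp add: h_def I_def)
      then have "(g n A x - g n A y) / 2 ^ n < (1 / 2) / 2 ^ n"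
        by (simp add: diff_divide_distrib)
      then have "g n A x - g n A y < 1 / 2" unfolding divide_less_cancel by simp
      then show ?thesis using g01[OF A(1) y(1)] A(2) by linarith
    qed
    then show "\<exists>A\<in>\<A> n. \<forall>y\<in>M. d' x y < 1 / 2 / 2 ^ n \<longrightarrow> y \<in> A" using A(1) by blast
  qed
  then have "\<exists>\<epsilon>>0. \<forall>x\<in>M. \<exists>A\<in>\<A> n. \<forall>y\<in>M. d' x y < \<epsilon> \<longrightarrow> y \<in> A" for n
    by (intro exI[of _ "1 / 2 / 2 ^ n"]) simp
  then show thesis using that d' by blast
qed

section \<open>Construction of the metric\<close>

text \<open>Members of a star-finite cover meet only finitely many others, so a finite union of members
  reaches only a finite union of members in one step below the Lebesgue number.\<close>

lemma chain_in_finite_union: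
  assumes sf: "star_finite \<A>" and "\<Union>\<A> = M" and "a \<in> M"
    and leb: "\<And>x. x \<in> M \<Longrightarrow> \<exists>A\<in>\<A>. mball x \<epsilon> \<subseteq> A"
  shows "finitely_covered \<A> ((small_steps \<epsilon> ^^ n) `` {a})"
proof (induction n)
  case 0
  obtain A where "A \<in> \<A>" "a \<in> A" using assms by blast
  then show ?case unfolding finitely_covered_def by (intro exI[of _ "{A}"]) auto
next
  case (Suc n)
  then obtain \<H> where H: "\<H> \<subseteq> \<A>" "finite \<H>" "(small_steps \<epsilon> ^^ n) `` {a} \<subseteq> \<Union>\<H>"
    unfolding finitely_covered_def by blast
  define \<K> where "\<K> = (\<Union>A\<in>\<H>. {B \<in> \<A>. A \<inter> B \<noteq> {}})"
  have "finite \<K>" unfolding \<K>_def using H sf unfolding star_finite_def by blast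
  moreover have "(small_steps \<epsilon> ^^ Suc n) `` {a} \<subseteq> \<Union>\<K>"
  proof
    fix y assume "y \<in> (small_steps \<epsilon> ^^ Suc n) `` {a}"
    then obtain z where z: "z \<in> (small_steps \<epsilon> ^^ n) `` {a}" "z \<in> M" "y \<in> M" "d z y < \<epsilon>"
      by (auto simp: small_steps_def)
    obtain A where A: "A \<in> \<H>" "z \<in> A" using z(1) H(3) by blast
    obtain B where B: "B \<in> \<A>" "mball z \<epsilon> \<subseteq> B" using leb[OF z(2)] by blast
    have "0 < \<epsilon>" using z(4) nonneg[of z y] by linarith
    then have "z \<in> B" "y \<in> B" using B z by auto
    then show "y \<in> \<Union>\<K>" unfolding \<K>_def using A B by blast
  qed
  moreover have "\<K> \<subseteq> \<A>" unfolding \<K>_def by blast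
  ultimately show ?case unfolding finitely_covered_def by (intro exI[of _ \<K>]) simp
qed

text \<open>The balls of radius \<open>1/(n+1)\<close> centred in \<open>K\<close> form a base of neighbourhoods of the
  compact set \<open>K\<close>. The lemma also covers the case of an empty \<open>K\<close>.\<close>

lemma finitely_covered_neighbourhood_of_compact:
  assumes K: "compactin mtopology K" and G: "open_cover_of mtopology \<G>"
  shows "\<exists>n::nat. finitely_covered \<G> (\<Union>k\<in>K. mball k (1 / Suc n))"
proof -
  obtain \<H> where H: "\<H> \<subseteq> \<G>" "finite \<H>" "K \<subseteq> \<Union>\<H>"
    using finitely_covered_compactin[OF K G] unfolding finitely_covered_def by blast
  have "openin mtopology U" if "U \<in> \<H>" for U
    using G H that unfolding open_cover_of_def by blast
  then obtain \<epsilon> where e: "\<epsilon> > 0" "\<And>x. x \<in> K \<Longrightarrow> \<exists>U\<in>\<H>. mball x \<epsilon> \<subseteq> U"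
    using lebesgue_number[OF K H(3)] by blast
  obtain n where n: "1 / Suc n < \<epsilon>" using nat_approx_posE[OF e(1)] by auto
  have "(\<Union>k\<in>K. mball k (1 / Suc n)) \<subseteq> \<Union>\<H>"
  proof (rule UN_least)
    fix k assume "k \<in> K"
    then show "mball k (1 / Suc n) \<subseteq> \<Union>\<H>"
      using e(2)[of k] mball_subset_concentric[of "1 / Suc n" \<epsilon> k] n by (meson Union_upper less_imp_le order_trans)
  qed
  then show ?thesis unfolding finitely_covered_def using H(1,2) by (intro exI[of _ n] exI[of _ \<H>]) simp
qed

text \<open>For each \<open>n\<close>, take a star-finite open refinement of the cover by the neighbourhood \<open>V n\<close> of
  \<open>nlc\<close> and all open sets contained in compact sets. In a metric for which all these refinements
  have Lebesgue numbers, the points reached from a given point by chains of a given length at the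
  \<open>n\<close>-th scale lie in the union of \<open>V n\<close> and a compact set. Given an open
  cover, some \<open>V n\<close> is covered by finitely many of its members.\<close>

lemma chain_covering_metric_exists:
  assumes sp: "strongly_paracompact mtopology" and K: "compactin mtopology (nlc mtopology)"
  obtains d' where "Metric_space M d'" "Metric_space.mtopology M d' = mtopology"
    and "Metric_space.chain_covering M d'"
proof -
  define V where "V n = (\<Union>k\<in>nlc mtopology. mball k (1 / Suc n))" for n :: nat
  define \<C> where "\<C> n = insert (V n) {U. openin mtopology U \<and> (\<exists>C. compactin mtopology C \<and> U \<subseteq> C)}" for n
  have C_cover: "open_cover_of mtopology (\<C> n)" for n
    unfolding open_cover_of_def
  proof (intro conjI ballI)
    have "openin mtopology (V n)" unfolding V_def by (intro openin_Union) auto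
    then show open_C: "openin mtopology U" if "U \<in> \<C> n" for U
      using that unfolding \<C>_def by blast
    have "x \<in> \<Union>(\<C> n)" if x: "x \<in> M" for x
    proof (cases "x \<in> nlc mtopology")
      case True
      then have "x \<in> V n" unfolding V_def using x by force
      then show ?thesis unfolding \<C>_def by blast
    next
      case False
      then show ?thesis using x unfolding nlc_def \<C>_def by auto
    qed
    then show "\<Union>(\<C> n) = topspace mtopology"
      using open_C openin_subset by fastforce
  qed
  have "\<exists>\<A>. open_cover_of mtopology \<A> \<and> refines \<A> (\<C> n) \<and> star_finite \<A>" for n
    using sp C_cover[of n] unfolding strongly_paracompact_def by blast
  then obtain \<A> where \<A>: "\<And>n. open_cover_of mtopology (\<A> n)" "\<And>n. refines (\<A> n) (\<C> n)"
    "\<And>n. star_finite (\<A> n)"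
    by metis
  obtain d' where d': "Metric_space M d'" "Metric_space.mtopology M d' = mtopology"
    and leb: "\<And>n. \<exists>\<epsilon>>0. \<forall>x\<in>M. \<exists>A\<in>\<A> n. \<forall>y\<in>M. d' x y < \<epsilon> \<longrightarrow> y \<in> A"
    by (rule metric_with_Lebesgue_numbers[of \<A>, OF \<A>(1)]) blast
  interpret D': Metric_space M d' by (rule d')
  have D'.chain_covering
    unfolding D'.chain_covering_def d'(2)
  proof (intro allI impI)
    fix \<G> assume G: "open_cover_of mtopology \<G>"
    obtain n where n: "finitely_covered \<G> (V n)"
      using finitely_covered_neighbourhood_of_compact[OF K G] unfolding V_def by blast
    obtain \<epsilon> where e: "\<epsilon> > 0" and leb_n: "\<And>x. x \<in> M \<Longrightarrow> \<exists>A\<in>\<A> n. D'.mball x \<epsilon> \<subseteq> A"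
      using leb[of n] by (metis D'.in_mball subsetI)
    have A_fin: "finitely_covered \<G> A" if A: "A \<in> \<A> n" for A
    proof -
      obtain C where "C \<in> \<C> n" "A \<subseteq> C" using \<A>(2)[of n] A unfolding refines_def by blast
      then consider "A \<subseteq> V n" | C where "compactin mtopology C" "A \<subseteq> C"
        unfolding \<C>_def by blast
      then show ?thesis
        using n finitely_covered_compactin[OF _ G] finitely_covered_subset by cases blast+
    qed
    have "finitely_covered \<G> ((D'.small_steps \<epsilon> ^^ m) `` {a})" if a: "a \<in> M" for a m
    proof -
      have "\<Union>(\<A> n) = M" using \<A>(1)[of n] unfolding open_cover_of_def by simp
      then obtain \<H> where H: "\<H> \<subseteq> \<A> n" "finite \<H>" "(D'.small_steps \<epsilon> ^^ m) `` {a} \<subseteq> \<Union>\<H>"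
        using D'.chain_in_finite_union[OF \<A>(3)[of n] _ a leb_n, of m]
        unfolding finitely_covered_def by blast
      have "finitely_covered \<G> (\<Union>A\<in>\<H>. A)"
        by (rule finitely_covered_UN[OF H(2)]) (use H(1) A_fin in blast)
      then show ?thesis using H(3) finitely_covered_subset by simp
    qed
    then show "\<exists>\<epsilon>>0. \<forall>a\<in>M. \<forall>m. finitely_covered \<G> ((D'.small_steps \<epsilon> ^^ m) `` {a})"
      using e by blast
  qed
  then show thesis using that d' by blast
qed

end

theorem theorem2p2p23:
  fixes X :: "'a topology"
  assumes "metrizable_space X"
  shows "((\<exists>d. metrizes d X \<and> Metric_space.cofinally_Bourbaki_complete (topspace X) d)
            \<longleftrightarrow> strongly_paracompact X \<and> compactin X (nlc X))
       \<and> ((\<exists>d. metrizes d X \<and> Metric_space.uniformly_strongly_paracompact (topspace X) d)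
            \<longleftrightarrow> strongly_paracompact X \<and> compactin X (nlc X))
       \<and> (\<forall>d. metrizes d X \<longrightarrow>
            (Metric_space.cofinally_Bourbaki_complete (topspace X) d \<longleftrightarrow>
             Metric_space.uniformly_strongly_paracompact (topspace X) d))"
proof -
  have equiv: "Metric_space.cofinally_Bourbaki_complete (topspace X) d \<longleftrightarrow>
      Metric_space.uniformly_strongly_paracompact (topspace X) d" if "metrizes d X" for d
    using that Metric_space.cofinally_Bourbaki_complete_iff_uniformly_strongly_paracompact
    unfolding metrizes_def by blast
  have forward: "strongly_paracompact X \<and> compactin X (nlc X)"
    if d: "metrizes d X" and usp: "Metric_space.uniformly_strongly_paracompact (topspace X) d" for d
  proof -
    interpret Metric_space "topspace X" d using d unfolding metrizes_def by blast
    have X: "mtopology = X" using d unfolding metrizes_def by blast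
    have chain_covering
      using usp cofinally_Bourbaki_complete_iff_uniformly_strongly_paracompact
        cofinally_Bourbaki_complete_imp_chain_covering by blast
    then show ?thesis
      using uniformly_strongly_paracompact_imp_strongly_paracompact[OF usp]
        chain_covering_imp_compactin_nlc unfolding X by blast
  qed
  have backward: "\<exists>d. metrizes d X \<and> Metric_space.uniformly_strongly_paracompact (topspace X) d"
    if sp: "strongly_paracompact X" and K: "compactin X (nlc X)"
  proof -
    obtain M d where "Metric_space M d" and X: "X = Metric_space.mtopology M d"
      using assms unfolding metrizable_space_def by blast
    then interpret Metric_space M d by blast
    have "topspace X = M" unfolding X by simp
    obtain d' where "Metric_space M d'" "Metric_space.mtopology M d' = mtopology"
      "Metric_space.chain_covering M d'"
      using chain_covering_metric_exists sp K unfolding X by blast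
    then show ?thesis
      using Metric_space.chain_covering_imp_uniformly_strongly_paracompact[of M d']
      unfolding metrizes_def \<open>topspace X = M\<close> X by auto
  qed
  show ?thesis using equiv forward backward by blast
qed

end
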